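(* Let $\mathbf{Z}\in QH(\eta,\theta;\sigma,\tau;\gamma)$ be defined on $(0,\infty)$. Suppose that there are real numbers $T>0$ and $z_T$ such that the bridge $\mathbf{X}=(X_t)_{t\in(0,T)}$ of $\mathbf{Z}$ between points $(0,0)$ and $(T,z_T)$ exists, that $$\kappa^2=\Big(1+\frac{\tau}{T}\Big)\Big(1+\theta\frac{z_T}{T}+\tau\frac{z_T^2}{T^2}\Big)>0,$$ and that the process $$Y_t=\frac{T+\tau}{T\kappa}\Big(\big(1+\tfrac tT\big)X_{Tt/(t+T)}-\tfrac tT z_T\Big),\qquad t\in(0,\infty),$$ is a $q$-Meixner process, in the sense that its parameters $$\theta_Y=\frac{\theta+2\tau z_T/T}{\kappa},\quad \eta_Y=\frac{T\eta-\theta-2\tau z_T/T-(1-\gamma)z_T}{T\kappa},\quad \tau_Y=\frac{T\tau}{T+\tau},$$ $$\sigma_Y=\frac{\sigma T^2+(1-\gamma)T+\tau}{T(T+\tau)},\quad \gamma_Y=\frac{T\gamma-\tau}{T+\tau}$$ as a member of $QH(\eta_Y,\theta_Y;\sigma_Y,\tau_Y;\gamma_Y)$ satisfy $\eta_Y=\sigma_Y=0$, $\tau_Y\ge0$ and $-1\le\gamma_Y\le1$. Then $\mathbf{Y}$ is a Meixner process (that is, $\gamma_Y=1$), and one of the following cases must happen: (i) $\gamma=1$, $\sigma=\tau=0$ and $\eta=\theta=0$; (ii) $\gamma=1$, $\sigma=\tau=0$ and $\eta\theta>0$; (iii) $\sigma,\tau>0$, $\gamma=1+2\sqrt{\sigma\tau}$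 and $\eta\sqrt\tau=\theta\sqrt\sigma$.
   Context: **Natural past-future filtration.** For a process $(X_t)_{t\in\mathcal{T}}$ on an open interval $\mathcal{T}$: $\mathcal{F}_{s,t}=\sigma(X_r: r\in\mathcal{T},\ r\le s\text{ or }r\ge t)$ for $s<t$ in $\mathcal{T}$. **Notation $QH$.** $\mathbf{X}\in QH(\eta,\theta;\sigma,\tau;\gamma)$ on $\mathcal{T}\subset(0,\infty)$ means that $\mathbf{X}=(X_t)_{t\in\mathcal{T}}$ is square-integrable, $\mathbb{E}(X_t)=0$, $\mathbb{E}(X_sX_t)=\min\{s,t\}$, for all $s<t<u$ in $\mathcal{T}$ $$\mathbb{E}(X_t|\mathcal{F}_{s,u})=\frac{u-t}{u-s}X_s+\frac{t-s}{u-s}X_u,$$ and there is a non-random function $F_{t,s,u}$ of $s<t<u$ such that $$\operatorname{Var}(X_t|\mathcal{F}_{s,u})=F_{t,s,u}\Big(1+\eta\tfrac{uX_s-sX_u}{u-s}+\theta\tfrac{X_u-X_s}{u-s}+\sigma\tfrac{(uX_s-sX_u)^2}{(u-s)^2}+\tau\tfrac{(X_u-X_s)^2}{(u-s)^2}-(1-\gamma)\tfrac{(X_u-X_s)(uX_s-sX_u)}{(u-s)^2}\Big),$$ with $(\mathcal{F}_{s,u})$ the natural past-future filtration. **$q$-Meixner and Meixner processes.** A $q$-Meixner process is a process on $(0,\infty)$ in $QH(0,\theta;0,\tau;\gamma)$ with $\tau\ge0$, $-1\le\gamma\le1$; it is a Meixner process if $\gamma=1$. **Bridge.** A process $(X_t)_{t\in(r,v)}$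 is a bridge between points $(r,z_r)$ and $(v,z_v)$ of a process $(Z_t)_{t\in\mathcal{T}}$ with $(r,v)\subset\mathcal{T}$ if: (1) $\lim_{t\to r^+}X_t=z_r$ and $\lim_{t\to v^-}X_t=z_v$ in probability; (2) for $r<t_1<\dots<t_m<v$ the law of $(X_{t_1},\dots,X_{t_m})$ is absolutely continuous with respect to the law of $(Z_{t_1},\dots,Z_{t_m})$; (3) for $r<s_1<\dots<s_k<t_1<\dots<t_m<u_1<\dots<u_n<v$, writing $Z_{\mathbf t}=(Z_{t_1},\dots,Z_{t_m})$ etc., and any function $g$ with $g(Z_{\mathbf t})$ integrable, if $\mathbb{E}(g(Z_{\mathbf t})|Z_{\mathbf s},Z_{\mathbf u})=h(Z_{\mathbf s},Z_{\mathbf u})$ a.s., then $\mathbb{E}(g(X_{\mathbf t})|X_{\mathbf s},X_{\mathbf u})=h(X_{\mathbf s},X_{\mathbf u})$ a.s. (conditional expectation in the extended sense if $g(X_{\mathbf t})$ is not integrable). *)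

theory Defs
  imports "HOL-Probability.Probability"
begin

text \<open>A real stochastic process indexed by a set of times is a function
  \<open>X :: real \<Rightarrow> 'a \<Rightarrow> real\<close>; its values outside the index set are irrelevant.\<close>

definition generated_sigma :: "'a measure \<Rightarrow> (real \<Rightarrow> 'a \<Rightarrow> real) \<Rightarrow> real set \<Rightarrow> 'a measure" where
  "generated_sigma M X I =
     sigma (space M) (\<Union>r\<in>I. {X r -` B \<inter> space M | B. B \<in> sets borel})"

definition past_future :: "'a measure \<Rightarrow> real set \<Rightarrow> (real \<Rightarrow> 'a \<Rightarrow> real) \<Rightarrow> real \<Rightarrow> real \<Rightarrow> 'a measure" where
  "past_future M \<T> X s t = generated_sigma M X {r \<in> \<T>. r \<le> s \<or> t \<le> r}"

definition cond_var :: "'a measure \<Rightarrow> 'a measure \<Rightarrow> ('a \<Rightarrow> real) \<Rightarrow> 'a \<Rightarrow> real" where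
  "cond_var M \<F> f = real_cond_exp M \<F> (\<lambda>\<omega>. (f \<omega> - real_cond_exp M \<F> f \<omega>)\<^sup>2)"

definition QH :: "'a measure \<Rightarrow> real set \<Rightarrow> (real \<Rightarrow> 'a \<Rightarrow> real)
    \<Rightarrow> real \<Rightarrow> real \<Rightarrow> real \<Rightarrow> real \<Rightarrow> real \<Rightarrow> bool" where
  "QH M \<T> X \<eta> \<theta> \<sigma> \<tau> \<gamma> \<longleftrightarrow>
     prob_space M \<and> open \<T> \<and> is_interval \<T> \<and> \<T> \<noteq> {} \<and> \<T> \<subseteq> {0<..} \<and>
     (\<forall>t\<in>\<T>. X t \<in> borel_measurable M \<and> integrable M (\<lambda>\<omega>. (X t \<omega>)\<^sup>2)) \<and>
     (\<forall>t\<in>\<T>. (\<integral>\<omega>. X t \<omega> \<partial>M) = 0) \<and>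
     (\<forall>s\<in>\<T>. \<forall>t\<in>\<T>. (\<integral>\<omega>. X s \<omega> * X t \<omega> \<partial>M) = min s t) \<and>
     (\<forall>s\<in>\<T>. \<forall>t\<in>\<T>. \<forall>u\<in>\<T>. s < t \<and> t < u \<longrightarrow>
        (AE \<omega> in M. real_cond_exp M (past_future M \<T> X s u) (X t) \<omega>
            = (u - t) / (u - s) * X s \<omega> + (t - s) / (u - s) * X u \<omega>)) \<and>
     (\<exists>F :: real \<Rightarrow> real \<Rightarrow> real \<Rightarrow> real.
        \<forall>s\<in>\<T>. \<forall>t\<in>\<T>. \<forall>u\<in>\<T>. s < t \<and> t < u \<longrightarrow>
        (AE \<omega> in M. cond_var M (past_future M \<T> X s u) (X t) \<omega>
            = F t s u *
              (1 + \<eta> * ((u * X s \<omega> - s * X u \<omega>) / (u - s))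
                 + \<theta> * ((X u \<omega> - X s \<omega>) / (u - s))
                 + \<sigma> * ((u * X s \<omega> - s * X u \<omega>)\<^sup>2 / (u - s)\<^sup>2)
                 + \<tau> * ((X u \<omega> - X s \<omega>)\<^sup>2 / (u - s)\<^sup>2)
                 - (1 - \<gamma>) * ((X u \<omega> - X s \<omega>) * (u * X s \<omega> - s * X u \<omega>) / (u - s)\<^sup>2))))"

definition q_meixner_process :: "'a measure \<Rightarrow> (real \<Rightarrow> 'a \<Rightarrow> real)
    \<Rightarrow> real \<Rightarrow> real \<Rightarrow> real \<Rightarrow> bool" where
  "q_meixner_process M X \<theta> \<tau> \<gamma> \<longleftrightarrow>
     QH M {0<..} X 0 \<theta> 0 \<tau> \<gamma> \<and> 0 \<le> \<tau> \<and> -1 \<le> \<gamma> \<and> \<gamma> \<le> 1"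

definition meixner_process :: "'a measure \<Rightarrow> (real \<Rightarrow> 'a \<Rightarrow> real) \<Rightarrow> real \<Rightarrow> real \<Rightarrow> bool" where
  "meixner_process M X \<theta> \<tau> \<longleftrightarrow> q_meixner_process M X \<theta> \<tau> 1"

definition lim_in_prob :: "'a measure \<Rightarrow> (real \<Rightarrow> 'a \<Rightarrow> real) \<Rightarrow> real \<Rightarrow> real filter \<Rightarrow> bool" where
  "lim_in_prob M X z G \<longleftrightarrow>
     (\<forall>\<epsilon>>0. ((\<lambda>t. measure M {\<omega> \<in> space M. \<bar>X t \<omega> - z\<bar> > \<epsilon>}) \<longlongrightarrow> 0) G)"

text \<open>A tuple of times \<open>t\<^sub>1 < \<dots> < t\<^sub>m\<close> is encoded by the finite set \<open>J\<close> of its entries, and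
  the vector \<open>(X\<^bsub>t\<^sub>1\<^esub>, \<dots>, X\<^bsub>t\<^sub>m\<^esub>)\<close> by the corresponding element of the product space over \<open>J\<close>.\<close>

definition at_times :: "(real \<Rightarrow> 'a \<Rightarrow> real) \<Rightarrow> real set \<Rightarrow> 'a \<Rightarrow> real \<Rightarrow> real" where
  "at_times X J \<omega> = (\<lambda>t\<in>J. X t \<omega>)"

definition fd_law :: "'a measure \<Rightarrow> (real \<Rightarrow> 'a \<Rightarrow> real) \<Rightarrow> real set \<Rightarrow> (real \<Rightarrow> real) measure" where
  "fd_law M X J = distr M (\<Pi>\<^sub>M t\<in>J. borel) (at_times X J)"

text \<open>Conditional expectation in the extended sense, for \<open>f\<close> that need not be integrable:
  \<open>E(f\<^sup>+|\<F>) - E(f\<^sup>-|\<F>)\<close> is well defined and equals the real-valued \<open>h\<close> almost surely. This forces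
  \<open>E(|f| |\<F>)\<close> to be finite almost surely, which has to be required separately since
  \<^const>\<open>real_cond_exp\<close> replaces infinite values by 0.\<close>

definition has_cond_exp_ext :: "'a measure \<Rightarrow> 'a measure \<Rightarrow> ('a \<Rightarrow> real) \<Rightarrow> ('a \<Rightarrow> real) \<Rightarrow> bool" where
  "has_cond_exp_ext M \<F> f h \<longleftrightarrow>
     (AE \<omega> in M. nn_cond_exp M \<F> (\<lambda>\<omega>. ennreal \<bar>f \<omega>\<bar>) \<omega> < \<infinity>) \<and>
     (AE \<omega> in M. real_cond_exp M \<F> f \<omega> = h \<omega>)"

text \<open>\<open>X\<close> (on the probability space \<open>N\<close>) is a bridge of \<open>Z\<close> (on \<open>M\<close>, indexed by \<open>\<T>\<close>) between the
  points \<open>(r, z\<^sub>r)\<close> and \<open>(v, z\<^sub>v)\<close>. In the last condition all three tuples of times are nonempty: a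
  bridge does not preserve one-sided or unconditional expectations.\<close>

definition is_bridge :: "'b measure \<Rightarrow> (real \<Rightarrow> 'b \<Rightarrow> real) \<Rightarrow> 'a measure \<Rightarrow> real set \<Rightarrow>
    (real \<Rightarrow> 'a \<Rightarrow> real) \<Rightarrow> real \<times> real \<Rightarrow> real \<times> real \<Rightarrow> bool" where
  "is_bridge N X M \<T> Z = (\<lambda>(r, z\<^sub>r) (v, z\<^sub>v).
     prob_space M \<and> (\<forall>t\<in>\<T>. Z t \<in> borel_measurable M) \<and>
     prob_space N \<and> r < v \<and> {r<..<v} \<subseteq> \<T> \<and>
     (\<forall>t\<in>{r<..<v}. X t \<in> borel_measurable N) \<and>
     lim_in_prob N X z\<^sub>r (at_right r) \<and> lim_in_prob N X z\<^sub>v (at_left v) \<and>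
     (\<forall>J. finite J \<and> J \<noteq> {} \<and> J \<subseteq> {r<..<v} \<longrightarrow>
        absolutely_continuous (fd_law M Z J) (fd_law N X J)) \<and>
     (\<forall>S J U g h.
        finite S \<and> finite J \<and> finite U \<and> S \<noteq> {} \<and> J \<noteq> {} \<and> U \<noteq> {} \<and>
        S \<union> J \<union> U \<subseteq> {r<..<v} \<and> (\<forall>s\<in>S. \<forall>t\<in>J. s < t) \<and> (\<forall>t\<in>J. \<forall>u\<in>U. t < u) \<and>
        g \<in> borel_measurable (\<Pi>\<^sub>M t\<in>J. borel) \<and>
        h \<in> borel_measurable ((\<Pi>\<^sub>M s\<in>S. borel) \<Otimes>\<^sub>M (\<Pi>\<^sub>M u\<in>U. borel)) \<and>
        integrable M (\<lambda>\<omega>. g (at_times Z J \<omega>)) \<and>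
        (AE \<omega> in M. real_cond_exp M (generated_sigma M Z (S \<union> U)) (\<lambda>\<omega>. g (at_times Z J \<omega>)) \<omega>
            = h (at_times Z S \<omega>, at_times Z U \<omega>))
        \<longrightarrow> has_cond_exp_ext N (generated_sigma N X (S \<union> U)) (\<lambda>\<omega>. g (at_times X J \<omega>))
              (\<lambda>\<omega>. h (at_times X S \<omega>, at_times X U \<omega>))))"

end

theory Submission
  imports Defs
begin

text \<open>Taking expectations in the formula for the conditional variance shows that
  \<open>u - s + \<sigma> u s + \<tau> + (1 - \<gamma>) s\<close> never vanishes for \<open>0 < s < u\<close>: its product with
  the constant \<open>F\<^bsub>t,s,u\<^esub>\<close> is, up to the factor \<open>u - s\<close>, the expected conditional variance,
  which is positive. By connectedness the expression is positive, and the limits \<open>s \<rightarrow> 0\<close> and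
  \<open>u \<rightarrow> s\<close> give \<open>\<sigma>, \<tau> \<ge> 0\<close> and \<open>\<gamma> \<le> 1 + 2 \<surd>(\<sigma> \<tau>)\<close>. The equation \<open>\<sigma>\<^sub>Y = 0\<close> says that
  \<open>\<gamma> - 1 = \<sigma> T + \<tau> / T\<close>, so that the arithmetic-geometric mean inequality holds with equality.\<close>

lemma subalgebra_generated_sigma:
  assumes "\<And>r. r \<in> I \<Longrightarrow> X r \<in> borel_measurable M"
  shows "subalgebra M (generated_sigma M X I)"
proof -
  have sub: "(\<Union>r\<in>I. {X r -` B \<inter> space M | B. B \<in> sets borel}) \<subseteq> sets M"
    using assms by (auto intro: measurable_sets)
  then have "(\<Union>r\<in>I. {X r -` B \<inter> space M | B. B \<in> sets borel}) \<subseteq> Pow (space M)"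
    using sets.space_closed by blast
  with sub show ?thesis
    unfolding subalgebra_def generated_sigma_def
    by (simp add: sets.sigma_sets_subset)
qed

text \<open>Taking conditional expectations preserves the integral, and the inner conditional
  expectation may be replaced almost everywhere by \<open>g\<close>. For the linear interpolant of a
  \<open>QH\<close> process the right-hand side is computable from covariances alone.\<close>

lemma (in prob_space) integral_cond_var_linear:
  assumes sub: "subalgebra M \<F>"
    and f: "f \<in> borel_measurable M" "g \<in> borel_measurable M"
    and int: "integrable M (\<lambda>\<omega>. (f \<omega> - g \<omega>)\<^sup>2)"
    and ce: "AE \<omega> in M. real_cond_exp M \<F> f \<omega> = g \<omega>"
  shows "(\<integral>\<omega>. cond_var M \<F> f \<omega> \<partial>M) = (\<integral>\<omega>. (f \<omega> - g \<omega>)\<^sup>2 \<partial>M)"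
proof -
  interpret finite_measure_subalgebra M \<F>
    using sub by unfold_locales
  have meas: "(\<lambda>\<omega>. (f \<omega> - real_cond_exp M \<F> f \<omega>)\<^sup>2) \<in> borel_measurable M"
    using f borel_measurable_cond_exp2[of M \<F> f] by measurable
  have eq: "AE \<omega> in M. (f \<omega> - real_cond_exp M \<F> f \<omega>)\<^sup>2 = (f \<omega> - g \<omega>)\<^sup>2"
    using ce by eventually_elim simp
  have "integrable M (\<lambda>\<omega>. (f \<omega> - real_cond_exp M \<F> f \<omega>)\<^sup>2)"
    using integrable_cong_AE[OF meas _ eq] int f by auto
  then have "(\<integral>\<omega>. cond_var M \<F> f \<omega> \<partial>M) = (\<integral>\<omega>. (f \<omega> - real_cond_exp M \<F> f \<omega>)\<^sup>2 \<partial>M)"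
    unfolding cond_var_def by (rule real_cond_exp_int(2))
  also have "\<dots> = (\<integral>\<omega>. (f \<omega> - g \<omega>)\<^sup>2 \<partial>M)"
    using f by (intro integral_cong_AE meas eq) auto
  finally show ?thesis .
qed

lemma integrable_mult_of_squares:
  fixes f g :: "'a \<Rightarrow> real"
  assumes "f \<in> borel_measurable M" "g \<in> borel_measurable M"
    and "integrable M (\<lambda>\<omega>. (f \<omega>)\<^sup>2)" "integrable M (\<lambda>\<omega>. (g \<omega>)\<^sup>2)"
  shows "integrable M (\<lambda>\<omega>. f \<omega> * g \<omega>)"
proof (rule Bochner_Integration.integrable_bound)
  show "integrable M (\<lambda>\<omega>. (f \<omega>)\<^sup>2 + (g \<omega>)\<^sup>2)"
    using assms by simp
  show "AE \<omega> in M. norm (f \<omega> * g \<omega>) \<le> norm ((f \<omega>)\<^sup>2 + (g \<omega>)\<^sup>2)"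
  proof (rule AE_I2)
    fix \<omega>
    have "2 * (\<bar>f \<omega>\<bar> * \<bar>g \<omega>\<bar>) \<le> (f \<omega>)\<^sup>2 + (g \<omega>)\<^sup>2"
      using sum_squares_bound[of "\<bar>f \<omega>\<bar>" "\<bar>g \<omega>\<bar>"] by simp
    moreover have "0 \<le> \<bar>f \<omega>\<bar> * \<bar>g \<omega>\<bar>"
      by simp
    ultimately show "norm (f \<omega> * g \<omega>) \<le> norm ((f \<omega>)\<^sup>2 + (g \<omega>)\<^sup>2)"
      unfolding real_norm_def abs_mult by linarith
  qed
qed (use assms in simp)

text \<open>Integrating both formulas for the conditional variance equates a positive number with a
  constant times this expression. Nothing is known about the sign of that constant, so only
  nonvanishing follows here.\<close>

lemma QH_covariance_nonvanishing:
  assumes QH: "QH M {0<..} Z \<eta> \<theta> \<sigma> \<tau> \<gamma>" and su: "0 < s" "s < u"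
  shows "u - s + \<sigma> * u * s + \<tau> + (1 - \<gamma>) * s \<noteq> 0"
proof -
  interpret prob_space M
    using QH unfolding QH_def by blast
  \<comment> \<open>One intermediate time suffices; the midpoint gives both interpolation weights
    the value 1/2.\<close>
  define t where "t = (s + u) / 2"
  have t: "s < t" "t < u" "0 < t" "0 < u"
    using su by (auto simp: t_def)
  have w: "u - s \<noteq> 0"
    using su by simp
  have meas: "Z r \<in> borel_measurable M" and sq: "integrable M (\<lambda>\<omega>. (Z r \<omega>)\<^sup>2)"
    and mean: "(\<integral>\<omega>. Z r \<omega> \<partial>M) = 0" if "0 < r" for r
    using QH that unfolding QH_def by auto
  have cov: "(\<integral>\<omega>. Z p \<omega> * Z q \<omega> \<partial>M) = min p q" if "0 < p" "0 < q" for p q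
    using QH that unfolding QH_def by auto
  have int: "integrable M (Z r)" if "0 < r" for r
    using square_integrable_imp_integrable[OF meas sq] that by blast
  have int2: "integrable M (\<lambda>\<omega>. Z p \<omega> * Z q \<omega>)" if "0 < p" "0 < q" for p q
    using that by (intro integrable_mult_of_squares meas sq)
  note ints = int[OF su(1)] int[OF t(4)] int2[OF su(1) su(1)] int2[OF su(1) t(4)]
    int2[OF t(4) t(4)] int2[OF t(3) su(1)] int2[OF t(3) t(4)] int2[OF t(3) t(3)]
  note moments = mean[OF su(1)] mean[OF t(4)] cov[OF su(1) su(1)] cov[OF su(1) t(4)]
    cov[OF t(4) t(4)] cov[OF t(3) su(1)] cov[OF t(3) t(4)] cov[OF t(3) t(3)]
  define \<F> where "\<F> = past_future M {0<..} Z s u"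
  have sub: "subalgebra M \<F>"
    unfolding \<F>_def past_future_def
    by (rule subalgebra_generated_sigma) (auto intro: meas)
  define L where "L = (\<lambda>\<omega>. (Z s \<omega> + Z u \<omega>) / 2)"
  have "(u - t) / (u - s) = 1 / 2" "(t - s) / (u - s) = 1 / 2"
    using w by (auto simp: t_def field_simps)
  moreover have "AE \<omega> in M. real_cond_exp M \<F> (Z t) \<omega>
      = (u - t) / (u - s) * Z s \<omega> + (t - s) / (u - s) * Z u \<omega>"
    using QH su t unfolding QH_def \<F>_def by (simp del: times_divide_eq_left)
  ultimately have ce: "AE \<omega> in M. real_cond_exp M \<F> (Z t) \<omega> = L \<omega>"
    unfolding L_def add_divide_distrib by (simp only:) simp
  have dev: "(Z t \<omega> - L \<omega>)\<^sup>2 = Z t \<omega> * Z t \<omega> - Z t \<omega> * Z s \<omega> - Z t \<omega> * Z u \<omega>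
      + (1 / 4) * (Z s \<omega> * Z s \<omega>) + (1 / 2) * (Z s \<omega> * Z u \<omega>) + (1 / 4) * (Z u \<omega> * Z u \<omega>)" for \<omega>
    by (simp add: L_def power2_eq_square field_simps)
  have "(\<integral>\<omega>. cond_var M \<F> (Z t) \<omega> \<partial>M) = (\<integral>\<omega>. (Z t \<omega> - L \<omega>)\<^sup>2 \<partial>M)"
  proof (rule integral_cond_var_linear[OF sub _ _ _ ce])
    show "integrable M (\<lambda>\<omega>. (Z t \<omega> - L \<omega>)\<^sup>2)"
      unfolding dev using ints by simp
  qed (use meas su t in \<open>auto simp: L_def\<close>)
  also have "\<dots> = (u - s) / 4"
  proof -
    \<comment> \<open>Each product in \<open>dev\<close> integrates to the smaller of its two
      times.\<close>
    have "(\<integral>\<omega>. (Z t \<omega> - L \<omega>)\<^sup>2 \<partial>M) = t - s - t + (1 / 4) * s + (1 / 2) * s + (1 / 4) * u"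
      unfolding dev using ints moments su t by simp
    then show ?thesis
      by (simp add: t_def field_simps)
  qed
  finally have var: "(\<integral>\<omega>. cond_var M \<F> (Z t) \<omega> \<partial>M) = (u - s) / 4" .

  define Q where "Q = (\<lambda>\<omega>. 1 + \<eta> * ((u * Z s \<omega> - s * Z u \<omega>) / (u - s))
                 + \<theta> * ((Z u \<omega> - Z s \<omega>) / (u - s))
                 + \<sigma> * ((u * Z s \<omega> - s * Z u \<omega>)\<^sup>2 / (u - s)\<^sup>2)
                 + \<tau> * ((Z u \<omega> - Z s \<omega>)\<^sup>2 / (u - s)\<^sup>2)
                 - (1 - \<gamma>) * ((Z u \<omega> - Z s \<omega>) * (u * Z s \<omega> - s * Z u \<omega>) / (u - s)\<^sup>2))"
  have "s \<in> {0<..}" "t \<in> {0<..}" "u \<in> {0<..}" "s < t \<and> t < u"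
    using su t by auto
  then obtain c where c: "AE \<omega> in M. cond_var M \<F> (Z t) \<omega> = c * Q \<omega>"
    using QH unfolding QH_def \<F>_def Q_def by blast
  \<comment> \<open>The quadratic terms of \<open>Q\<close> are all products of two linear forms in
    \<open>Z s\<close> and \<open>Z u\<close>, so this one formula yields their three expectations
    \<open>AA\<close>, \<open>DD\<close> and \<open>DA\<close>.\<close>
  have bilinear: "integrable M (\<lambda>\<omega>. (a * Z s \<omega> + b * Z u \<omega>) * (c * Z s \<omega> + d * Z u \<omega>))"
    "(\<integral>\<omega>. (a * Z s \<omega> + b * Z u \<omega>) * (c * Z s \<omega> + d * Z u \<omega>) \<partial>M)
      = a * c * s + (a * d + b * c) * s + b * d * u" for a b c d
  proof -
    have *: "(a * Z s \<omega> + b * Z u \<omega>) * (c * Z s \<omega> + d * Z u \<omega>) = a * c * (Z s \<omega> * Z s \<omega>)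
      + (a * d + b * c) * (Z s \<omega> * Z u \<omega>) + b * d * (Z u \<omega> * Z u \<omega>)" for \<omega>
      by (simp add: algebra_simps)
    show "integrable M (\<lambda>\<omega>. (a * Z s \<omega> + b * Z u \<omega>) * (c * Z s \<omega> + d * Z u \<omega>))"
      unfolding * using ints by simp
    show "(\<integral>\<omega>. (a * Z s \<omega> + b * Z u \<omega>) * (c * Z s \<omega> + d * Z u \<omega>) \<partial>M)
      = a * c * s + (a * d + b * c) * s + b * d * u"
      unfolding * using ints moments su by simp
  qed
  have lin: "integrable M (\<lambda>\<omega>. u * Z s \<omega> - s * Z u \<omega>)" "integrable M (\<lambda>\<omega>. Z u \<omega> - Z s \<omega>)"
    "(\<integral>\<omega>. u * Z s \<omega> - s * Z u \<omega> \<partial>M) = 0" "(\<integral>\<omega>. Z u \<omega> - Z s \<omega> \<partial>M) = 0"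
    using ints moments by auto
  have AA: "integrable M (\<lambda>\<omega>. (u * Z s \<omega> - s * Z u \<omega>)\<^sup>2)"
    "(\<integral>\<omega>. (u * Z s \<omega> - s * Z u \<omega>)\<^sup>2 \<partial>M) = u * s * (u - s)"
    using bilinear[of u "-s" u "-s"] by (simp_all add: power2_eq_square algebra_simps)
  have DD: "integrable M (\<lambda>\<omega>. (Z u \<omega> - Z s \<omega>)\<^sup>2)" "(\<integral>\<omega>. (Z u \<omega> - Z s \<omega>)\<^sup>2 \<partial>M) = u - s"
    using bilinear[of "-1" 1 "-1" 1] by (simp_all add: power2_eq_square algebra_simps)
  have DA: "integrable M (\<lambda>\<omega>. (Z u \<omega> - Z s \<omega>) * (u * Z s \<omega> - s * Z u \<omega>))"
    "(\<integral>\<omega>. (Z u \<omega> - Z s \<omega>) * (u * Z s \<omega> - s * Z u \<omega>) \<partial>M) = - s * (u - s)"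
    using bilinear[of "-1" 1 u "-s"] by (simp_all add: algebra_simps)
  have "(\<integral>\<omega>. Q \<omega> \<partial>M) = 1 + \<sigma> * (u * s * (u - s) / (u - s)\<^sup>2) + \<tau> * ((u - s) / (u - s)\<^sup>2)
      - (1 - \<gamma>) * (- s * (u - s) / (u - s)\<^sup>2)"
    unfolding Q_def using lin AA DD DA prob_space
    \<comment> \<open>Differences are split only where the minuend is a sum: this takes the outer
      subtraction apart but leaves \<open>Z u - Z s\<close> whole, as \<open>lin\<close>,
      \<open>DD\<close> and \<open>DA\<close> need it.\<close>
    by (simp del: times_divide_eq_right Bochner_Integration.integral_diff
          add: Bochner_Integration.integral_diff[where f = "\<lambda>\<omega>. _ \<omega> + _ \<omega>"])
  also have "\<dots> = (u - s + \<sigma> * u * s + \<tau> + (1 - \<gamma>) * s) / (u - s)"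
  proof -
    have "1 + \<sigma> * (u * s * d / d\<^sup>2) + \<tau> * (d / d\<^sup>2) - (1 - \<gamma>) * (- s * d / d\<^sup>2)
        = (d + \<sigma> * u * s + \<tau> + (1 - \<gamma>) * s) / d" if "d \<noteq> 0" for d
      using that by (simp add: field_simps power2_eq_square)
    then show ?thesis
      using w by blast
  qed
  finally have EQ: "(\<integral>\<omega>. Q \<omega> \<partial>M) = (u - s + \<sigma> * u * s + \<tau> + (1 - \<gamma>) * s) / (u - s)" .
  have "(\<integral>\<omega>. cond_var M \<F> (Z t) \<omega> \<partial>M) = (\<integral>\<omega>. c * Q \<omega> \<partial>M)"
  proof (rule integral_cong_AE[OF _ _ c])
    show "cond_var M \<F> (Z t) \<in> borel_measurable M"
      unfolding cond_var_def by (rule borel_measurable_cond_exp2)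
    show "(\<lambda>\<omega>. c * Q \<omega>) \<in> borel_measurable M"
      unfolding Q_def using meas[OF su(1)] meas[OF t(4)] by measurable
  qed
  then have "c * (\<integral>\<omega>. Q \<omega> \<partial>M) \<noteq> 0"
    using var w by simp
  then show ?thesis
    using EQ by auto
qed

text \<open>A continuous function without zeros has constant sign on the connected region 0 < s < u,
  so one point with a positive value decides.\<close>

lemma QH_covariance_pos:
  assumes QH: "QH M {0<..} Z \<eta> \<theta> \<sigma> \<tau> \<gamma>" and su: "0 < s" "s < u"
  shows "u - s + \<sigma> * u * s + \<tau> + (1 - \<gamma>) * s > 0"
proof (rule ccontr)
  define \<phi> where "\<phi> = (\<lambda>(s, u). u - s + \<sigma> * u * s + \<tau> + (1 - \<gamma>) * s)"
  define C where "C = {(s, u). 0 < s \<and> s < (u::real)}"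
  assume "\<not> ?thesis"
  then have neg: "\<phi> (s, u) \<le> 0"
    by (simp add: \<phi>_def)
  \<comment> \<open>The point is chosen so that \<sigma> s' \<ge> -1/2 and \<gamma> s' \<le> 1/2;
    then \<phi> is at least u'/2 + \<tau> - 1/2, and u' makes this at least 1/2.\<close>
  define s' u' where "s' = 1 / (2 * (1 + \<bar>\<sigma>\<bar> + \<bar>\<gamma>\<bar>))" and "u' = 2 * \<bar>\<tau>\<bar> + 2"
  have s': "0 < s'" "\<bar>\<sigma>\<bar> * s' \<le> 1 / 2" "\<bar>\<gamma>\<bar> * s' \<le> 1 / 2" "s' \<le> 1 / 2"
    by (auto simp: s'_def divide_simps)
  have "\<bar>\<sigma> * s'\<bar> \<le> 1 / 2" "\<bar>\<gamma> * s'\<bar> \<le> 1 / 2"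
    using s' by (simp_all add: abs_mult)
  then have "- (1 / 2) \<le> \<sigma> * s'" "\<gamma> * s' \<le> 1 / 2"
    by linarith+
  moreover from this have "u' * (- (1 / 2)) \<le> u' * (\<sigma> * s')"
    by (intro mult_left_mono) (auto simp: u'_def)
  moreover have "\<phi> (s', u') = u' + u' * (\<sigma> * s') + \<tau> - \<gamma> * s'"
    by (simp add: \<phi>_def algebra_simps)
  ultimately have "\<phi> (s', u') > 0"
    using u'_def by linarith
  moreover have "connected (\<phi> ` C)"
  proof (rule connected_continuous_image)
    show "continuous_on C \<phi>"
      unfolding \<phi>_def case_prod_beta by (intro continuous_intros)
    \<comment> \<open>The region is an intersection of two open half-planes.\<close>
    have "C = {p. inner (1, 0) p > 0} \<inter> {p. inner (- 1, 1) p > 0}"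
      by (auto simp: C_def)
    then have "convex C"
      by (simp only: convex_Int convex_halfspace_gt)
    then show "connected C"
      by (rule convex_connected)
  qed
  moreover have "(s, u) \<in> C" "(s', u') \<in> C"
    using su s' by (auto simp: C_def u'_def)
  ultimately have "0 \<in> \<phi> ` C"
    using neg connected_contains_Icc[of "\<phi> ` C" "\<phi> (s, u)" "\<phi> (s', u')"] by auto
  then show False
    using QH_covariance_nonvanishing[OF QH] by (auto simp: \<phi>_def C_def)
qed

text \<open>All three bounds come from the quadratic inequality \<open>diag\<close>, the limit of
  positivity as u decreases to s: its behaviour near 0 and near infinity gives the signs of \<tau>
  and \<sigma>, and its value near the minimiser of \<sigma> s + \<tau> / s bounds \<gamma>.\<close>

lemma QH_parameters:
  assumes QH: "QH M {0<..} Z \<eta> \<theta> \<sigma> \<tau> \<gamma>"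
  shows "0 \<le> \<sigma>" "0 \<le> \<tau>" "\<gamma> \<le> 1 + 2 * sqrt (\<sigma> * \<tau>)"
proof -
  have diag: "0 \<le> \<sigma> * s * s + \<tau> + (1 - \<gamma>) * s" if "0 < s" for s
  proof (rule tendsto_lowerbound)
    show "((\<lambda>u. u - s + \<sigma> * u * s + \<tau> + (1 - \<gamma>) * s) \<longlongrightarrow> \<sigma> * s * s + \<tau> + (1 - \<gamma>) * s) (at_right s)"
      by (rule tendsto_eq_intros refl | simp)+
    show "\<forall>\<^sub>F u in at_right s. 0 \<le> u - s + \<sigma> * u * s + \<tau> + (1 - \<gamma>) * s"
      using eventually_at_right_less[of s]
      by eventually_elim (use QH_covariance_pos[OF QH that] in \<open>auto intro: less_imp_le\<close>)
  qed simp
  show \<tau>: "0 \<le> \<tau>"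
  proof (rule tendsto_lowerbound)
    show "((\<lambda>s. \<sigma> * s * s + \<tau> + (1 - \<gamma>) * s) \<longlongrightarrow> \<tau>) (at_right 0)"
      by (rule tendsto_eq_intros refl | simp)+
    show "\<forall>\<^sub>F s in at_right 0. 0 \<le> \<sigma> * s * s + \<tau> + (1 - \<gamma>) * s"
      using eventually_at_right_less[of 0] by eventually_elim (rule diag)
  qed simp
  \<comment> \<open>The substitution s = 1/x exchanges the roles of \<sigma> and \<tau>, turning the
    limit at infinity into one at 0.\<close>
  have recip: "0 \<le> \<sigma> + \<tau> * x * x + (1 - \<gamma>) * x" if "0 < x" for x
  proof -
    have "0 \<le> x * x * (\<sigma> * (1 / x) * (1 / x) + \<tau> + (1 - \<gamma>) * (1 / x))"
      using that by (intro mult_nonneg_nonneg diag) auto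
    also have "\<dots> = \<sigma> + \<tau> * x * x + (1 - \<gamma>) * x"
      using that by (simp add: field_simps)
    finally show ?thesis .
  qed
  show \<sigma>: "0 \<le> \<sigma>"
  proof (rule tendsto_lowerbound)
    show "((\<lambda>x. \<sigma> + \<tau> * x * x + (1 - \<gamma>) * x) \<longlongrightarrow> \<sigma>) (at_right 0)"
      by (rule tendsto_eq_intros refl | simp)+
    show "\<forall>\<^sub>F x in at_right 0. 0 \<le> \<sigma> + \<tau> * x * x + (1 - \<gamma>) * x"
      using eventually_at_right_less[of 0] by eventually_elim (rule recip)
  qed simp
  text \<open>The minimiser \<open>\<surd>\<tau> / \<surd>\<sigma>\<close> of \<open>\<sigma> s + \<tau> / s\<close> degenerates when \<open>\<sigma>\<close> or \<open>\<tau>\<close> vanishes; hence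
    the perturbation by \<open>e\<close>.\<close>
  show "\<gamma> \<le> 1 + 2 * sqrt (\<sigma> * \<tau>)"
  proof (rule tendsto_lowerbound)
    show "((\<lambda>e. 1 + 2 * ((sqrt \<sigma> + e) * (sqrt \<tau> + e))) \<longlongrightarrow> 1 + 2 * sqrt (\<sigma> * \<tau>)) (at_right 0)"
      by (rule tendsto_eq_intros refl | simp add: real_sqrt_mult)+
    show "\<forall>\<^sub>F e in at_right 0. \<gamma> \<le> 1 + 2 * ((sqrt \<sigma> + e) * (sqrt \<tau> + e))"
      using eventually_at_right_less[of 0]
    proof eventually_elim
      case (elim e)
      define a b where "a = sqrt \<sigma> + e" and "b = sqrt \<tau> + e"
      have pos: "0 < a" "0 < b" and "sqrt \<sigma> \<le> a" "sqrt \<tau> \<le> b"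
        using elim \<sigma> \<tau> by (auto simp: a_def b_def add_nonneg_pos)
      then have le: "\<sigma> \<le> a\<^sup>2" "\<tau> \<le> b\<^sup>2"
        by (auto simp: sqrt_le_D)
      \<comment> \<open>This is \<open>diag\<close> at the perturbed minimiser s = b/a, divided by
        s.\<close>
      have "0 \<le> (a / b) * (\<sigma> * (b / a) * (b / a) + \<tau> + (1 - \<gamma>) * (b / a))"
        using pos by (intro mult_nonneg_nonneg diag) auto
      also have "\<dots> = \<sigma> * (b / a) + \<tau> * (a / b) + (1 - \<gamma>)"
        using pos by (simp add: field_simps)
      also have "\<dots> \<le> a\<^sup>2 * (b / a) + b\<^sup>2 * (a / b) + (1 - \<gamma>)"
        using pos le by (intro add_mono mult_right_mono) auto
      also have "\<dots> = 2 * (a * b) + (1 - \<gamma>)"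
        using pos by (simp add: power2_eq_square)
      finally show ?case
        by (simp add: a_def b_def)
    qed
  qed simp
qed

theorem proposition2p7:
  fixes M :: "'a measure" and N :: "'b measure"
    and Z :: "real \<Rightarrow> 'a \<Rightarrow> real" and X Y :: "real \<Rightarrow> 'b \<Rightarrow> real"
    and \<eta> \<theta> \<sigma> \<tau> \<gamma> T z\<^sub>T \<kappa> :: real
    and \<eta>\<^sub>Y \<theta>\<^sub>Y \<sigma>\<^sub>Y \<tau>\<^sub>Y \<gamma>\<^sub>Y :: real
  assumes Z: "QH M {0<..} Z \<eta> \<theta> \<sigma> \<tau> \<gamma>"
    and T: "T > 0"
    and bridge: "is_bridge N X M {0<..} Z (0, 0) (T, z\<^sub>T)"
    and kappa: "\<kappa>\<^sup>2 = (1 + \<tau> / T) * (1 + \<theta> * (z\<^sub>T / T) + \<tau> * (z\<^sub>T\<^sup>2 / T\<^sup>2))"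
    and kappa_pos: "\<kappa>\<^sup>2 > 0"
    and Y: "\<forall>t>0. \<forall>\<omega>. Y t \<omega> =
      (T + \<tau>) / (T * \<kappa>) * ((1 + t / T) * X (T * t / (t + T)) \<omega> - t / T * z\<^sub>T)"
    and theta_Y: "\<theta>\<^sub>Y = (\<theta> + 2 * \<tau> * z\<^sub>T / T) / \<kappa>"
    and eta_Y: "\<eta>\<^sub>Y = (T * \<eta> - \<theta> - 2 * \<tau> * z\<^sub>T / T - (1 - \<gamma>) * z\<^sub>T) / (T * \<kappa>)"
    and tau_Y: "\<tau>\<^sub>Y = T * \<tau> / (T + \<tau>)"
    and sigma_Y: "\<sigma>\<^sub>Y = (\<sigma> * T\<^sup>2 + (1 - \<gamma>) * T + \<tau>) / (T * (T + \<tau>))"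
    and gamma_Y: "\<gamma>\<^sub>Y = (T * \<gamma> - \<tau>) / (T + \<tau>)"
    and Y_QH: "QH N {0<..} Y \<eta>\<^sub>Y \<theta>\<^sub>Y \<sigma>\<^sub>Y \<tau>\<^sub>Y \<gamma>\<^sub>Y"
    and Y_q_Meixner: "\<eta>\<^sub>Y = 0" "\<sigma>\<^sub>Y = 0" "\<tau>\<^sub>Y \<ge> 0" "-1 \<le> \<gamma>\<^sub>Y" "\<gamma>\<^sub>Y \<le> 1"
  shows "meixner_process N Y \<theta>\<^sub>Y \<tau>\<^sub>Y \<and> \<gamma>\<^sub>Y = 1 \<and>
    ((\<gamma> = 1 \<and> \<sigma> = 0 \<and> \<tau> = 0 \<and> \<eta> = 0 \<and> \<theta> = 0) \<or>
     (\<gamma> = 1 \<and> \<sigma> = 0 \<and> \<tau> = 0 \<and> \<eta> * \<theta> > 0) \<or>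
     (\<sigma> > 0 \<and> \<tau> > 0 \<and> \<gamma> = 1 + 2 * sqrt (\<sigma> * \<tau>) \<and> \<eta> * sqrt \<tau> = \<theta> * sqrt \<sigma>))"
proof -
  note par = QH_parameters[OF Z]
  have \<kappa>: "\<kappa> \<noteq> 0"
    using kappa_pos by auto
  have "\<sigma> * T\<^sup>2 + (1 - \<gamma>) * T + \<tau> = 0"
    using sigma_Y Y_q_Meixner(2) T par(2) by simp
  then have \<gamma>T: "(\<gamma> - 1) * T = \<sigma> * T\<^sup>2 + \<tau>"
    by (simp add: algebra_simps)
  \<comment> \<open>The square is T times the gap in the arithmetic-geometric mean inequality for
    \<sigma> T and \<tau> / T. The upper bound on \<gamma> makes it nonpositive, hence zero.\<close>
  have "(sqrt \<sigma> * T - sqrt \<tau>)\<^sup>2 = \<sigma> * T\<^sup>2 + \<tau> - 2 * sqrt (\<sigma> * \<tau>) * T"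
    using par by (simp add: power2_diff power_mult_distrib real_sqrt_mult)
  also have "\<dots> = (\<gamma> - 1 - 2 * sqrt (\<sigma> * \<tau>)) * T"
    using \<gamma>T by (simp add: algebra_simps)
  also have "\<dots> \<le> 0"
    using par(3) T by (intro mult_nonpos_nonneg) auto
  finally have "(sqrt \<sigma> * T - sqrt \<tau>)\<^sup>2 = 0"
    by (simp add: order_antisym)
  then have root: "sqrt \<tau> = sqrt \<sigma> * T"
    by simp
  then have "(sqrt \<tau>)\<^sup>2 = (sqrt \<sigma> * T)\<^sup>2"
    by simp
  then have \<tau>: "\<tau> = \<sigma> * T\<^sup>2"
    using par by (simp add: power_mult_distrib)
  have "(\<gamma> - 1) * T = (2 * \<sigma> * T) * T"
    using \<gamma>T \<tau> by (simp only: power2_eq_square)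
  then have \<gamma>: "\<gamma> - 1 = 2 * \<sigma> * T"
    using T by simp
  have "sqrt (\<sigma> * \<tau>) = \<sigma> * T"
    using par by (simp add: real_sqrt_mult root)
  then have \<gamma>': "\<gamma> = 1 + 2 * sqrt (\<sigma> * \<tau>)"
    using \<gamma> by simp
  have "T * \<gamma> - \<tau> = T + \<tau>"
    using \<gamma>T \<tau> by (simp add: algebra_simps)
  then have \<gamma>Y: "\<gamma>\<^sub>Y = 1"
    using gamma_Y T par(2) by simp
  \<comment> \<open>In the numerator of \<open>\<eta>\<^sub>Y\<close> the two terms with
    \<open>z\<^sub>T\<close> cancel, so its vanishing links \<theta> and \<eta> independently of the
    endpoint.\<close>
  have "2 * \<tau> * z\<^sub>T / T = 2 * \<sigma> * T * z\<^sub>T"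
    using T \<tau> by (simp add: power2_eq_square)
  also have "\<dots> = - ((1 - \<gamma>) * z\<^sub>T)"
    using \<gamma> by (simp add: algebra_simps)
  finally have \<theta>: "\<theta> = T * \<eta>"
    using eta_Y Y_q_Meixner(1) T \<kappa> by simp
  have "meixner_process N Y \<theta>\<^sub>Y \<tau>\<^sub>Y"
    using Y_QH Y_q_Meixner \<gamma>Y by (simp add: meixner_process_def q_meixner_process_def)
  moreover have "(\<gamma> = 1 \<and> \<sigma> = 0 \<and> \<tau> = 0 \<and> \<eta> = 0 \<and> \<theta> = 0) \<or>
     (\<gamma> = 1 \<and> \<sigma> = 0 \<and> \<tau> = 0 \<and> \<eta> * \<theta> > 0) \<or>
     (\<sigma> > 0 \<and> \<tau> > 0 \<and> \<gamma> = 1 + 2 * sqrt (\<sigma> * \<tau>) \<and> \<eta> * sqrt \<tau> = \<theta> * sqrt \<sigma>)"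
  \<comment> \<open>If \<sigma> = 0, then \<tau> = 0 and \<gamma> = 1, and \<theta> = T \<eta>
    separates (i) from (ii). Otherwise \<tau> = \<sigma> T^2 > 0, and \<open>root\<close> with
    \<open>\<theta>\<close> gives the last identity of (iii).\<close>
  proof (cases "\<sigma> = 0")
    case True
    have "\<eta> * \<theta> > 0" if "\<eta> \<noteq> 0"
    proof -
      have "\<eta> * \<theta> = T * (\<eta> * \<eta>)"
        using \<theta> by simp
      moreover have "0 < \<eta> * \<eta>"
        using that not_real_square_gt_zero by blast
      ultimately show ?thesis
        using T by (simp only: mult_pos_pos)
    qed
    with True show ?thesis
      using \<tau> \<gamma> \<theta> by auto
  next
    case False
    with par(1) T show ?thesis
      using \<gamma>' \<tau> \<theta> root by simp
  qed
  ultimately show ?thesis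
    using \<gamma>Y by blast
qed

end
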